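(* For every integer $t\geqslant1$ there exist infinitely many graphs $G$ with $\text{path-}\alpha(G)=t$ such that for every $\lambda\geqslant1$, $$\tau_{G,\lambda}\geqslant c_t(n\lambda)^t,$$ where $n=|V(G)|$ and $c_t>0$ is a constant depending only on $t$.
   Context: A path decomposition of $G$ is a sequence of bags $X_1,\dots,X_p\subseteq V(G)$ covering all vertices and edges such that the bags containing any given vertex form an interval; its independence number is $\max_i\alpha(G[X_i])$, and $\text{path-}\alpha(G)$ is the minimum independence number over all path decompositions. For $\lambda>0$: $\mathcal{I}(G)$ is the set of independent sets, $Z_G(\lambda)=\sum_{J\in\mathcal{I}(G)}\lambda^{|J|}$, $\pi_{G,\lambda}(I)=\lambda^{|I|}/Z_G(\lambda)$. The Glauber dynamics picks a uniform random vertex $v$; if $v\in I$ it is removed with probability $\frac1{\lambda+1}$; if $v\notin I$ and $I\cup\{v\}$ is independent it is added with probability $\frac{\lambda}{\lambda+1}$; otherwise nothing changes. The mixing time $\tau_{G,\lambda}$ is the least $t$ such that for every start, the total variation distance between the distribution after $t$ steps and $\pi_{G,\lambda}$ is at most $1/4$. *)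

theory Defs
  imports
    "HOL-Probability.Probability"
    "Graph_Theory.Digraph_Component"
    "Graph_Theory.Digraph_Isomorphism"
begin

text \<open>
  Finite simple graphs are digraphs satisfying the locale predicate \<^locale>\<open>graph\<close>: finite,
  without loops or parallel arcs, and symmetric, so that each edge is a pair of opposite arcs.
\<close>

definition independent_sets :: "('a, 'b) pre_digraph \<Rightarrow> 'a set set" where
  "independent_sets G = {I. I \<subseteq> verts G \<and> (\<forall>u\<in>I. \<forall>v\<in>I. \<not> u \<rightarrow>\<^bsub>G\<^esub> v)}"

definition independence_number :: "('a, 'b) pre_digraph \<Rightarrow> nat" where
  "independence_number G = Max (card ` independent_sets G)"

definition path_decomposition :: "('a, 'b) pre_digraph \<Rightarrow> 'a set list \<Rightarrow> bool" where
  "path_decomposition G Xs \<longleftrightarrow>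
     Xs \<noteq> [] \<and>
     (\<forall>X\<in>set Xs. X \<subseteq> verts G) \<and>
     (\<forall>v\<in>verts G. \<exists>X\<in>set Xs. v \<in> X) \<and>
     (\<forall>u v. u \<rightarrow>\<^bsub>G\<^esub> v \<longrightarrow> (\<exists>X\<in>set Xs. u \<in> X \<and> v \<in> X)) \<and>
     (\<forall>v i j k. i \<le> j \<and> j \<le> k \<and> k < length Xs \<and> v \<in> Xs ! i \<and> v \<in> Xs ! k \<longrightarrow> v \<in> Xs ! j)"

definition decomposition_independence :: "('a, 'b) pre_digraph \<Rightarrow> 'a set list \<Rightarrow> nat" where
  "decomposition_independence G Xs = Max ((\<lambda>X. independence_number (G \<restriction> X)) ` set Xs)"

definition path_alpha :: "('a, 'b) pre_digraph \<Rightarrow> nat" where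
  "path_alpha G =
     (LEAST k. \<exists>Xs. path_decomposition G Xs \<and> k = decomposition_independence G Xs)"

definition partition_function :: "('a, 'b) pre_digraph \<Rightarrow> real \<Rightarrow> real" where
  "partition_function G lam = (\<Sum>J\<in>independent_sets G. lam ^ card J)"

definition hardcore_pmf :: "('a, 'b) pre_digraph \<Rightarrow> real \<Rightarrow> 'a set pmf" where
  "hardcore_pmf G lam = embed_pmf
     (\<lambda>I. if I \<in> independent_sets G then lam ^ card I / partition_function G lam else 0)"

lemma finite_independent_sets:
  assumes "graph G"
  shows "finite (independent_sets G)"
proof -
  interpret graph G by fact
  have "independent_sets G \<subseteq> Pow (verts G)"
    by (auto simp: independent_sets_def)
  then show ?thesis
    using finite_verts finite_subset by blast
qed

lemma partition_function_pos:
  assumes "graph G" and "lam > 0"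
  shows "partition_function G lam > 0"
proof -
  have "{} \<in> independent_sets G"
    by (simp add: independent_sets_def)
  then show ?thesis
    unfolding partition_function_def
    using assms finite_independent_sets by (intro sum_pos) auto
qed

lemma pmf_hardcore:
  assumes "graph G" and "lam > 0"
  shows "pmf (hardcore_pmf G lam) I =
    (if I \<in> independent_sets G then lam ^ card I / partition_function G lam else 0)"
  unfolding hardcore_pmf_def
proof (rule pmf_embed_pmf)
  let ?w = "\<lambda>I. if I \<in> independent_sets G then lam ^ card I / partition_function G lam else 0"
  note Z = partition_function_pos[OF assms]
  show nn: "0 \<le> ?w I" for I
    using Z assms by simp
  have "(\<integral>\<^sup>+ I. ennreal (?w I) \<partial>count_space UNIV) = (\<Sum>I\<in>independent_sets G. ennreal (?w I))"
    by (rule nn_integral_count_space') (auto simp: finite_independent_sets assms)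
  also have "\<dots> = ennreal (\<Sum>I\<in>independent_sets G. ?w I)"
    by (rule sum_ennreal) (rule nn)
  also have "(\<Sum>I\<in>independent_sets G. ?w I) = 1"
    using Z by (simp add: sum_divide_distrib[symmetric] partition_function_def)
  finally show "(\<integral>\<^sup>+ I. ennreal (?w I) \<partial>count_space UNIV) = 1"
    by simp
qed

definition glauber_step :: "('a, 'b) pre_digraph \<Rightarrow> real \<Rightarrow> 'a set \<Rightarrow> 'a set pmf" where
  "glauber_step G lam I = do {
     v \<leftarrow> pmf_of_set (verts G);
     if v \<in> I then
       map_pmf (\<lambda>b. if b then I - {v} else I) (bernoulli_pmf (1 / (lam + 1)))
     else if I \<union> {v} \<in> independent_sets G then
       map_pmf (\<lambda>b. if b then I \<union> {v} else I) (bernoulli_pmf (lam / (lam + 1)))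
     else return_pmf I
   }"

primrec glauber :: "('a, 'b) pre_digraph \<Rightarrow> real \<Rightarrow> 'a set \<Rightarrow> nat \<Rightarrow> 'a set pmf" where
  "glauber G lam I 0 = return_pmf I"
| "glauber G lam I (Suc k) = bind_pmf (glauber G lam I k) (glauber_step G lam)"

definition total_variation :: "'a pmf \<Rightarrow> 'a pmf \<Rightarrow> real" where
  "total_variation p q = (SUP A. \<bar>measure_pmf.prob p A - measure_pmf.prob q A\<bar>)"

definition mixing_time :: "('a, 'b) pre_digraph \<Rightarrow> real \<Rightarrow> nat" where
  "mixing_time G lam =
     (LEAST k. \<forall>I\<in>independent_sets G.
        total_variation (glauber G lam I k) (hardcore_pmf G lam) \<le> 1 / 4)"

end

theory Submission
  imports Defs
begin

text \<open>
  Take two disjoint unions of \<open>t\<close> cliques of size \<open>k\<close> and join them completely, so that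
  \<open>n = 2tk\<close>. An independent set lies on one side and meets each clique at most once. Any path
  decomposition has a bag containing a whole side, hence path-\<open>\<alpha>\<close> is \<open>t\<close>. The Glauber dynamics
  can only pass from one side to the other through the empty set, whose stationary probability
  is \<open>1/Z \<le> (k\<lambda>)\<^sup>-\<^sup>t\<close>, while by symmetry the nonempty sets on either side
  have constant probability. The stationary chain therefore has crossed by time \<open>T\<close> with
  probability at most \<open>T/Z\<close>, whereas at the mixing time it has crossed with constant probability.
  Because \<open>LEAST\<close> on an empty predicate is unspecified, the argument also needs that the chain
  converges, which is Doeblin's argument: every state reaches the empty set within \<open>n\<close> steps.
\<close>

section \<open>Probability mass functions with finite support\<close>

text \<open>Law of total probability as a finite sum. All laws of the chain live on finitely many
  independent sets, so later estimates compare such sums term by term.\<close>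

lemma prob_bind_pmf_sum:
  assumes "finite W" "set_pmf p \<subseteq> W"
  shows "measure_pmf.prob (bind_pmf p f) A = (\<Sum>x\<in>W. pmf p x * measure_pmf.prob (f x) A)"
proof -
  have "ennreal (measure_pmf.prob (bind_pmf p f) A) = (\<integral>\<^sup>+x. ennreal (measure_pmf.prob (f x) A) \<partial>p)"
    by (simp flip: measure_pmf.emeasure_eq_measure)
  also have "\<dots> = ennreal (measure_pmf.expectation p (\<lambda>x. measure_pmf.prob (f x) A))"
    by (intro nn_integral_eq_integral measure_pmf.integrable_const_bound[where B = 1]) auto
  finally have "measure_pmf.prob (bind_pmf p f) A
      = measure_pmf.expectation p (\<lambda>x. measure_pmf.prob (f x) A)"
    by (subst (asm) ennreal_inj) (auto intro: integral_nonneg)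
  also have "\<dots> = (\<Sum>x\<in>W. pmf p x * measure_pmf.prob (f x) A)"
    using assms by (subst integral_measure_pmf_real[where A = W]) (auto simp: mult.commute)
  finally show ?thesis .
qed

lemma prob_eq_sum_pmf:
  assumes "finite W" "set_pmf p \<subseteq> W"
  shows "measure_pmf.prob p A = (\<Sum>x\<in>W \<inter> A. pmf p x)"
proof -
  have "measure_pmf.prob p A = measure_pmf.prob p (W \<inter> A)"
    using assms(2) by (intro measure_prob_cong_0) (auto simp: set_pmf_iff)
  then show ?thesis
    using assms(1) by (simp add: measure_measure_pmf_finite)
qed

lemma pmf_map_bernoulli:
  assumes "0 \<le> p" "p \<le> 1"
  shows "pmf (map_pmf f (bernoulli_pmf p)) y
    = (if f True = y then p else 0) + (if f False = y then 1 - p else 0)"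
  using assms by (simp add: map_pmf_def pmf_bind indicator_def)

lemma total_variation_ge: "\<bar>measure_pmf.prob p A - measure_pmf.prob q A\<bar> \<le> total_variation p q"
  unfolding total_variation_def
proof (rule cSUP_upper)
  have "\<bar>measure_pmf.prob p A - measure_pmf.prob q A\<bar> \<le> 1" for A
    using measure_pmf.prob_le_1[of p A] measure_pmf.prob_le_1[of q A]
      measure_nonneg[of p A] measure_nonneg[of q A] by linarith
  then show "bdd_above (range (\<lambda>A. \<bar>measure_pmf.prob p A - measure_pmf.prob q A\<bar>))"
    by (intro bdd_aboveI2[where M = 1])
qed simp

text \<open>One step of the Doeblin contraction: mass \<open>d\<close> that both \<open>p\<close> and \<open>q\<close> put on \<open>z\<close> cancels.\<close>
lemma minorized_average_diff_le:
  fixes a :: "'a \<Rightarrow> real"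
  assumes fin: "finite W" and "set_pmf p \<subseteq> W" "set_pmf q \<subseteq> W"
    and z: "z \<in> W" "d \<le> pmf p z" "d \<le> pmf q z"
    and osc: "\<And>x y. x \<in> W \<Longrightarrow> y \<in> W \<Longrightarrow> a x - a y \<le> r"
    and "d \<le> 1"
  shows "(\<Sum>x\<in>W. pmf p x * a x) - (\<Sum>x\<in>W. pmf q x * a x) \<le> (1 - d) * r"
proof -
  define M where "M = Max (a ` W)"
  define m where "m = Min (a ` W)"
  have M: "a x \<le> M" and m: "m \<le> a x" if "x \<in> W" for x
    using that fin by (auto simp: M_def m_def)
  have "M \<in> a ` W" "m \<in> a ` W"
    using fin z(1) unfolding M_def m_def by (auto intro!: Max_in Min_in)
  then have r: "M - m \<le> r"
    using osc by auto
  \<comment> \<open>Only at \<open>z\<close> is the exact value \<open>a z\<close> kept; elsewhere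
    \<open>a\<close> is replaced by its maximum for \<open>p\<close> and by its minimum for
    \<open>q\<close>. With \<open>d\<close> in place of the masses at \<open>z\<close>, the terms
    \<open>d * a z\<close> cancel in the difference and \<open>(1 - d) * (M - m)\<close>
    remains.\<close>
  have "(\<Sum>x\<in>W. pmf p x * a x) \<le> (\<Sum>x\<in>W. pmf p x * M - (if x = z then pmf p z * (M - a z) else 0))"
    by (intro sum_mono) (auto simp: algebra_simps intro: mult_right_mono M)
  also have "\<dots> = M - pmf p z * (M - a z)"
    using fin z(1) sum_pmf_eq_1[OF fin assms(2)]
    by (simp add: sum_subtractf flip: sum_distrib_right)
  also have "\<dots> \<le> M - d * (M - a z)"
    using z M[OF z(1)] by (intro diff_left_mono mult_right_mono) auto
  finally have p: "(\<Sum>x\<in>W. pmf p x * a x) \<le> M - d * (M - a z)" .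
  have "m + d * (a z - m) \<le> m + pmf q z * (a z - m)"
    using z m[OF z(1)] by (intro add_left_mono mult_right_mono) auto
  also have "\<dots> = (\<Sum>x\<in>W. pmf q x * m + (if x = z then pmf q z * (a z - m) else 0))"
    using fin z(1) sum_pmf_eq_1[OF fin assms(3)]
    by (simp add: sum.distrib flip: sum_distrib_right)
  also have "\<dots> \<le> (\<Sum>x\<in>W. pmf q x * a x)"
    by (intro sum_mono) (auto simp: algebra_simps intro: mult_right_mono m)
  finally have "(\<Sum>x\<in>W. pmf p x * a x) - (\<Sum>x\<in>W. pmf q x * a x) \<le> (1 - d) * (M - m)"
    using p by (simp add: algebra_simps)
  also have "\<dots> \<le> (1 - d) * r"
    using r \<open>d \<le> 1\<close> by (intro mult_left_mono) auto
  finally show ?thesis .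
qed

section \<open>Glauber dynamics\<close>

lemma empty_independent [simp]: "{} \<in> independent_sets G"
  by (simp add: independent_sets_def)

lemma independent_sets_subset: "I \<in> independent_sets G \<Longrightarrow> J \<subseteq> I \<Longrightarrow> J \<in> independent_sets G"
  by (auto simp: independent_sets_def)

text \<open>Markov property. The recursion of \<open>glauber\<close> appends a last step, whereas
  the Doeblin argument splits off an initial stretch.\<close>

lemma glauber_add: "glauber G lam I (j + k) = bind_pmf (glauber G lam I j) (\<lambda>J. glauber G lam J k)"
  by (induction k) (simp_all add: bind_return_pmf' bind_assoc_pmf)

text \<open>One step with the vertex fixed. Each such update is already reversible for
  \<open>hardcore_pmf\<close>, and the random choice of the vertex merely mixes them.\<close>

definition site_update :: "('a, 'b) pre_digraph \<Rightarrow> real \<Rightarrow> 'a \<Rightarrow> 'a set \<Rightarrow> 'a set pmf" where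
  "site_update G lam v I =
    (if v \<in> I then
       map_pmf (\<lambda>b. if b then I - {v} else I) (bernoulli_pmf (1 / (lam + 1)))
     else if I \<union> {v} \<in> independent_sets G then
       map_pmf (\<lambda>b. if b then I \<union> {v} else I) (bernoulli_pmf (lam / (lam + 1)))
     else return_pmf I)"

lemma glauber_step_eq:
  "glauber_step G lam I = bind_pmf (pmf_of_set (verts G)) (\<lambda>v. site_update G lam v I)"
  by (simp add: glauber_step_def site_update_def)

locale hardcore_chain = graph +
  fixes lam :: real
  assumes lam_pos: "lam > 0" and verts_nonempty: "verts G \<noteq> {}"
begin

abbreviation "\<Omega> \<equiv> independent_sets G"
abbreviation "\<pi> \<equiv> hardcore_pmf G lam"
abbreviation "run \<equiv> glauber G lam"

lemma graph_G: "graph G"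
  by unfold_locales

lemma finite_states: "finite \<Omega>"
  by (rule finite_independent_sets[OF graph_G])

lemma pmf_stationary:
  "pmf \<pi> I = (if I \<in> \<Omega> then lam ^ card I / partition_function G lam else 0)"
  by (rule pmf_hardcore[OF graph_G lam_pos])

lemma set_stationary: "set_pmf \<pi> \<subseteq> \<Omega>"
  by (auto simp: set_pmf_iff pmf_stationary split: if_splits)

lemma card_insert_independent: "I \<in> \<Omega> \<Longrightarrow> v \<notin> I \<Longrightarrow> card (insert v I) = Suc (card I)"
  using finite_subset[OF _ finite_verts] by (simp add: independent_sets_def)

lemma set_site_update: "J \<in> set_pmf (site_update G lam v I) \<Longrightarrow>
    J = I \<or> J = I - {v} \<or> J = I \<union> {v} \<and> J \<in> \<Omega>"
  by (auto simp: site_update_def split: if_splits)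

lemma set_glauber_step:
  "set_pmf (glauber_step G lam I) = (\<Union>v\<in>verts G. set_pmf (site_update G lam v I))"
  by (simp add: glauber_step_eq verts_nonempty)

lemma site_update_closed: "set_pmf (site_update G lam v I) \<subseteq> \<Omega>" if I: "I \<in> \<Omega>"
proof
  fix J assume "J \<in> set_pmf (site_update G lam v I)"
  then consider "J = I" | "J = I - {v}" | "J \<in> \<Omega>"
    using set_site_update by blast
  then show "J \<in> \<Omega>"
    using I independent_sets_subset[OF I, of "I - {v}"] by cases auto
qed

lemma step_closed: "I \<in> \<Omega> \<Longrightarrow> set_pmf (glauber_step G lam I) \<subseteq> \<Omega>"
  unfolding set_glauber_step by (intro UN_least site_update_closed)

lemma run_closed: "set_pmf (run I k) \<subseteq> \<Omega>" if "I \<in> \<Omega>"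
proof (induction k)
  case (Suc k)
  then show ?case
    unfolding glauber.simps set_bind_pmf by (intro UN_least step_closed) auto
qed (use that in simp)

text \<open>Two distinct states exchange mass only if they differ exactly by \<open>v\<close>. Then
  removal and insertion have probabilities \<open>1 / (lam + 1)\<close> and
  \<open>lam / (lam + 1)\<close>, and their ratio \<open>lam\<close> matches the ratio of the
  weights.\<close>

lemma detailed_balance:
  assumes "I \<in> \<Omega>"
  shows "pmf \<pi> I * pmf (site_update G lam v I) J = pmf \<pi> J * pmf (site_update G lam v J) I"
proof -
  have l: "0 \<le> 1 / (lam + 1)" "1 / (lam + 1) \<le> 1" "0 \<le> lam / (lam + 1)" "lam / (lam + 1) \<le> 1"
    using lam_pos by auto
  have Z: "partition_function G lam > 0"
    by (rule partition_function_pos[OF graph_G lam_pos])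
  have key: "pmf \<pi> I * pmf (site_update G lam v I) J = pmf \<pi> J * pmf (site_update G lam v J) I"
    if "J \<in> \<Omega>" "v \<notin> J" "I = J \<union> {v}" "I \<in> \<Omega>" for I J
  proof -
    have "pmf (site_update G lam v I) J = 1 / (lam + 1)"
      using that l by (auto simp: site_update_def pmf_map_bernoulli)
    moreover have "pmf (site_update G lam v J) I = lam / (lam + 1)"
      using that l by (auto simp: site_update_def pmf_map_bernoulli)
    ultimately show ?thesis
      using that card_insert_independent[of J v] by (simp add: pmf_stationary)
  qed
  consider "I = J" | "v \<notin> J" "I = J \<union> {v}" | "v \<notin> I" "J = I \<union> {v}"
    | "I \<noteq> J" "\<not> (v \<notin> J \<and> I = J \<union> {v})" "\<not> (v \<notin> I \<and> J = I \<union> {v})" by blast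
  then show ?thesis
  proof cases
    case 2
    then have "J \<in> \<Omega>"
      by (intro independent_sets_subset[OF assms]) auto
    with 2 assms key show ?thesis by blast
  next
    case 3
    show ?thesis
    proof (cases "J \<in> \<Omega>")
      case True
      with 3 assms key[of I J] show ?thesis by simp
    next
      \<comment> \<open>A forbidden insertion: the update stays at \<open>I\<close>, and
        \<open>J\<close> has weight 0, so both sides vanish.\<close>
      case False
      with 3 show ?thesis
        by (auto simp: site_update_def pmf_stationary indicator_def)
    qed
  next
    case 4
    then have "J \<notin> set_pmf (site_update G lam v I)" "I \<notin> set_pmf (site_update G lam v J)"
      by (auto dest!: set_site_update)
    then show ?thesis
      by (simp add: set_pmf_iff)
  qed simp
qed

lemma site_update_stationary: "bind_pmf \<pi> (site_update G lam v) = \<pi>"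
proof (rule pmf_eqI)
  fix J
  have "pmf (bind_pmf \<pi> (site_update G lam v)) J
      = (\<Sum>I\<in>\<Omega>. pmf \<pi> I * pmf (site_update G lam v I) J)"
    using prob_bind_pmf_sum[OF finite_states set_stationary, of "site_update G lam v" "{J}"]
    by (simp add: measure_pmf_single)
  also have "\<dots> = pmf \<pi> J * (\<Sum>I\<in>\<Omega>. pmf (site_update G lam v J) I)"
    unfolding sum_distrib_left by (intro sum.cong refl detailed_balance)
  also have "\<dots> = pmf \<pi> J"
    using sum_pmf_eq_1[OF finite_states site_update_closed]
    by (cases "J \<in> \<Omega>") (auto simp: pmf_stationary)
  finally show "pmf (bind_pmf \<pi> (site_update G lam v)) J = pmf \<pi> J" .
qed

lemma step_stationary: "bind_pmf \<pi> (glauber_step G lam) = \<pi>"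
  unfolding glauber_step_eq by (subst bind_commute_pmf) (simp add: site_update_stationary)

lemma run_stationary: "bind_pmf \<pi> (\<lambda>I. run I k) = \<pi>"
  by (induction k) (simp_all add: bind_return_pmf' step_stationary flip: bind_assoc_pmf)

text \<open>The vertices of \<open>I - X\<close> can be removed one at a time, and spare steps can
  be idle. Allowing spare steps makes one time serve all starting states.\<close>

lemma shrink_reachable:
  assumes "I \<in> \<Omega>" "X \<subseteq> I" "card (I - X) \<le> k"
  shows "X \<in> set_pmf (run I k)"
  using assms(2,3)
proof (induction k arbitrary: X)
  case 0
  have "finite I"
    using assms(1) finite_subset[OF _ finite_verts] by (simp add: independent_sets_def)
  with 0 have "X = I" by auto
  then show ?case by simp
next
  case (Suc k)
  have fin: "finite I" and sub: "I \<subseteq> verts G"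
    using assms(1) finite_subset[OF _ finite_verts] by (auto simp: independent_sets_def)
  have step: "X \<in> set_pmf (run I (Suc k))"
    if "Y \<in> set_pmf (run I k)" "v \<in> verts G" "X \<in> set_pmf (site_update G lam v Y)" for Y v
    using that verts_nonempty by (auto simp: glauber_step_eq)
  show ?case
  proof (cases "X = I")
    case True
    obtain v where v: "v \<in> verts G"
      using verts_nonempty by auto
    have "X \<in> set_pmf (site_update G lam v X)"
      using lam_pos by (auto simp: site_update_def image_iff)
    with True Suc.IH[of X] v step show ?thesis by auto
  next
    case False
    then obtain v where v: "v \<in> I" "v \<notin> X"
      using Suc.prems by auto
    have "I - insert v X = (I - X) - {v}" by auto
    then have "card (I - insert v X) \<le> k"
      using Suc.prems v fin by (simp add: card_Diff_singleton)
    then have "insert v X \<in> set_pmf (run I k)"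
      using v Suc.prems by (intro Suc.IH) auto
    moreover have "X \<in> set_pmf (site_update G lam v (insert v X))"
      using lam_pos v by (auto simp: site_update_def image_iff)
    ultimately show ?thesis
      using step v sub by blast
  qed
qed

text \<open>After the first \<open>m\<close> steps both laws have mass at least \<open>d\<close> at
  the empty set; the rest of the run, as a function of the state reached, oscillates by at most
  \<open>(1 - d) ^ j\<close> by induction. Each stretch of \<open>m\<close> steps thus gains a
  factor \<open>1 - d\<close>.\<close>

lemma oscillation_contraction:
  assumes d: "\<And>I. I \<in> \<Omega> \<Longrightarrow> d \<le> pmf (run I m) {}" and "d \<le> 1"
    and "I \<in> \<Omega>" "J \<in> \<Omega>"
  shows "measure_pmf.prob (run I (j * m)) A - measure_pmf.prob (run J (j * m)) A \<le> (1 - d) ^ j"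
  using assms(3,4)
proof (induction j arbitrary: I J)
  case 0
  show ?case by (simp add: indicator_def)
next
  case (Suc j)
  have split: "measure_pmf.prob (run I (Suc j * m)) A
      = (\<Sum>X\<in>\<Omega>. pmf (run I m) X * measure_pmf.prob (run X (j * m)) A)" if "I \<in> \<Omega>" for I
    using prob_bind_pmf_sum[OF finite_states run_closed[OF that]]
    by (simp add: glauber_add)
  show ?case
    unfolding split[OF Suc.prems(1)] split[OF Suc.prems(2)] power_Suc
    by (intro minorized_average_diff_le[OF finite_states run_closed run_closed empty_independent]
        d Suc \<open>d \<le> 1\<close>)
qed

lemma mixing_time_attained:
  "\<forall>I\<in>\<Omega>. total_variation (run I (mixing_time G lam)) \<pi> \<le> 1 / 4"
proof -
  \<comment> \<open>\<open>card (verts G)\<close> steps suffice to empty any independent set, and a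
    minimum over finitely many positive probabilities is positive.\<close>
  define m where "m = card (verts G)"
  define d where "d = Min ((\<lambda>I. pmf (run I m) {}) ` \<Omega>)"
  have d: "d \<le> pmf (run I m) {}" if "I \<in> \<Omega>" for I
    using that finite_states by (simp add: d_def)
  have "{} \<in> set_pmf (run I m)" if "I \<in> \<Omega>" for I
    using that unfolding m_def
    by (intro shrink_reachable) (auto simp: independent_sets_def intro: card_mono)
  moreover have "d \<in> (\<lambda>I. pmf (run I m) {}) ` \<Omega>"
    unfolding d_def using finite_states empty_independent[of G] by (intro Min_in finite_imageI) blast+
  ultimately have "d > 0"
    by (auto simp: pmf_positive)
  have "d \<le> 1"
    by (rule order_trans[OF d[OF empty_independent] pmf_le_1])
  obtain j where j: "(1 - d) ^ j < 1 / 4"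
    using real_arch_pow_inv[of "1/4" "1 - d"] \<open>d > 0\<close> by auto
  have osc: "measure_pmf.prob (run I (j * m)) A - measure_pmf.prob (run J (j * m)) A \<le> 1 / 4"
    if "I \<in> \<Omega>" "J \<in> \<Omega>" for I J A
    by (rule order_trans[OF oscillation_contraction[OF d \<open>d \<le> 1\<close> that] less_imp_le[OF j]])
  have "\<bar>measure_pmf.prob (run I (j * m)) A - measure_pmf.prob \<pi> A\<bar> \<le> 1 / 4" if I: "I \<in> \<Omega>" for I A
  proof -
    let ?f = "\<lambda>J. measure_pmf.prob (run J (j * m)) A"
    have one: "(\<Sum>J\<in>\<Omega>. pmf \<pi> J) = 1"
      by (rule sum_pmf_eq_1[OF finite_states set_stationary])
    \<comment> \<open>By stationarity \<open>\<pi>\<close> is a mixture of runs, so the distance to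
      \<open>\<pi>\<close> is an average of differences between two runs, each at most 1/4.\<close>
    have "measure_pmf.prob \<pi> A = (\<Sum>J\<in>\<Omega>. pmf \<pi> J * ?f J)"
      using prob_bind_pmf_sum[OF finite_states set_stationary, of "\<lambda>J. run J (j * m)"]
      by (simp add: run_stationary)
    then have "?f I - measure_pmf.prob \<pi> A = (\<Sum>J\<in>\<Omega>. pmf \<pi> J * (?f I - ?f J))"
      by (simp add: right_diff_distrib sum_subtractf one flip: sum_distrib_right)
    moreover have "\<bar>\<Sum>J\<in>\<Omega>. pmf \<pi> J * (?f I - ?f J)\<bar> \<le> (\<Sum>J\<in>\<Omega>. pmf \<pi> J * (1 / 4))"
    proof (intro order_trans[OF sum_abs] sum_mono)
      fix J assume J: "J \<in> \<Omega>"
      show "\<bar>pmf \<pi> J * (?f I - ?f J)\<bar> \<le> pmf \<pi> J * (1 / 4)"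
        unfolding abs_mult using osc[OF I J, of A] osc[OF J I, of A]
        by (intro mult_mono) (simp_all only: abs_le_iff abs_of_nonneg pmf_nonneg order_refl, auto)
    qed
    ultimately show ?thesis
      using one by (simp flip: sum_distrib_right sum_divide_distrib)
  qed
  then have "\<forall>I\<in>\<Omega>. total_variation (run I (j * m)) \<pi> \<le> 1 / 4"
    unfolding total_variation_def by (intro ballI cSUP_least) simp_all
  then show ?thesis
    unfolding mixing_time_def by (rule LeastI)
qed

text \<open>At each step, the stationary chain enters \<open>S\<close> with probability at most that of being at
  the empty set.\<close>
lemma bottleneck_flow:
  assumes block: "\<And>J. J \<in> \<Omega> \<Longrightarrow> J \<notin> S \<Longrightarrow> J \<noteq> {} \<Longrightarrow> set_pmf (glauber_step G lam J) \<inter> S = {}"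
  shows "(\<Sum>I\<in>\<Omega> - S. pmf \<pi> I * measure_pmf.prob (run I k) S) \<le> real k * pmf \<pi> {}"
proof (induction k)
  case 0
  show ?case by (auto intro!: sum_nonpos)
next
  case (Suc k)
  have step: "measure_pmf.prob (run I (Suc k)) S \<le> measure_pmf.prob (run I k) S + pmf (run I k) {}"
    if I: "I \<in> \<Omega>" for I
  proof -
    have "measure_pmf.prob (run I (Suc k)) S
        = (\<Sum>J\<in>\<Omega>. pmf (run I k) J * measure_pmf.prob (glauber_step G lam J) S)"
      using prob_bind_pmf_sum[OF finite_states run_closed[OF I]] by simp
    \<comment> \<open>A step can end in \<open>S\<close> only from \<open>S\<close> itself or from
      the empty set; the mass of both is charged in full.\<close>
    also have "\<dots> \<le> (\<Sum>J\<in>\<Omega>. (if J \<in> S then pmf (run I k) J else 0)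
        + (if J = {} then pmf (run I k) J else 0))"
    proof (rule sum_mono)
      fix J assume "J \<in> \<Omega>"
      show "pmf (run I k) J * measure_pmf.prob (glauber_step G lam J) S
        \<le> (if J \<in> S then pmf (run I k) J else 0) + (if J = {} then pmf (run I k) J else 0)"
      proof (cases "J \<in> S \<or> J = {}")
        case True
        have "pmf (run I k) J * measure_pmf.prob (glauber_step G lam J) S \<le> pmf (run I k) J"
          by (rule mult_left_le) auto
        also have "\<dots> \<le> (if J \<in> S then pmf (run I k) J else 0) + (if J = {} then pmf (run I k) J else 0)"
          using True by auto
        finally show ?thesis .
      next
        case False
        then have "measure_pmf.prob (glauber_step G lam J) S = 0"
          unfolding measure_pmf_zero_iff using \<open>J \<in> \<Omega>\<close> block by blast
        then show ?thesis by simp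
      qed
    qed
    also have "\<dots> = measure_pmf.prob (run I k) S + pmf (run I k) {}"
      using finite_states
      by (simp add: sum.distrib prob_eq_sum_pmf[OF finite_states run_closed[OF I]] sum.inter_restrict)
    finally show ?thesis .
  qed
  have "(\<Sum>I\<in>\<Omega> - S. pmf \<pi> I * measure_pmf.prob (run I (Suc k)) S)
      \<le> (\<Sum>I\<in>\<Omega> - S. pmf \<pi> I * (measure_pmf.prob (run I k) S + pmf (run I k) {}))"
    by (intro sum_mono mult_left_mono step) auto
  also have "\<dots> = (\<Sum>I\<in>\<Omega> - S. pmf \<pi> I * measure_pmf.prob (run I k) S)
      + (\<Sum>I\<in>\<Omega> - S. pmf \<pi> I * pmf (run I k) {})"
    by (simp add: algebra_simps sum.distrib)
  \<comment> \<open>Enlarging the sum to all of \<open>\<Omega>\<close> starts the chain from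
    \<open>\<pi>\<close>, so the chance of sitting at the empty set at time \<open>k\<close> becomes
    \<open>pmf \<pi> {}\<close>.\<close>
  also have "(\<Sum>I\<in>\<Omega> - S. pmf \<pi> I * pmf (run I k) {}) \<le> (\<Sum>I\<in>\<Omega>. pmf \<pi> I * pmf (run I k) {})"
    using finite_states by (intro sum_mono2) auto
  also have "\<dots> = pmf \<pi> {}"
    using prob_bind_pmf_sum[OF finite_states set_stationary, of "\<lambda>I. run I k" "{{}}"]
    by (simp add: measure_pmf_single run_stationary)
  finally show ?case
    using Suc.IH by (simp add: algebra_simps)
qed

text \<open>Starts outside \<open>S\<close> have stationary weight \<open>1 - s\<close>, and at the
  mixing time each must be in \<open>S\<close> with probability at least \<open>s - 1 / 4\<close>.
  The flow bound allows at most \<open>T / Z\<close> in total, since the empty set has weight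
  \<open>1 / Z\<close>.\<close>

lemma mixing_time_bottleneck:
  assumes "\<And>J. J \<in> \<Omega> \<Longrightarrow> J \<notin> S \<Longrightarrow> J \<noteq> {} \<Longrightarrow> set_pmf (glauber_step G lam J) \<inter> S = {}"
  defines "s \<equiv> measure_pmf.prob \<pi> S"
  shows "(1 - s) * (s - 1 / 4) * partition_function G lam \<le> real (mixing_time G lam)"
proof -
  let ?T = "mixing_time G lam"
  have Z: "partition_function G lam > 0"
    by (rule partition_function_pos[OF graph_G lam_pos])
  have "1 - s = measure_pmf.prob \<pi> (- S)"
    unfolding s_def using measure_pmf.prob_compl[of S \<pi>] by (simp flip: Compl_eq_Diff_UNIV)
  also have "\<dots> = (\<Sum>I\<in>\<Omega> - S. pmf \<pi> I)"
    by (simp add: prob_eq_sum_pmf[OF finite_states set_stationary] Diff_eq)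
  finally have "(1 - s) * (s - 1 / 4) = (\<Sum>I\<in>\<Omega> - S. pmf \<pi> I * (s - 1 / 4))"
    by (simp add: sum_distrib_right)
  also have "\<dots> \<le> (\<Sum>I\<in>\<Omega> - S. pmf \<pi> I * measure_pmf.prob (run I ?T) S)"
  proof (intro sum_mono mult_left_mono)
    fix I assume "I \<in> \<Omega> - S"
    then have "\<bar>measure_pmf.prob (run I ?T) S - s\<bar> \<le> 1 / 4"
      unfolding s_def
      by (intro order_trans[OF total_variation_ge mixing_time_attained[rule_format]]) simp
    then show "s - 1 / 4 \<le> measure_pmf.prob (run I ?T) S" by linarith
  qed simp
  also have "\<dots> \<le> real ?T * pmf \<pi> {}"
    by (rule bottleneck_flow) fact
  also have "\<dots> = real ?T / partition_function G lam"
    by (simp add: pmf_stationary)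
  finally show ?thesis
    using Z by (simp add: pos_le_divide_eq)
qed

end

section \<open>Path decompositions of complete joins\<close>

lemma (in wf_digraph) independent_sets_induce:
  "X \<subseteq> verts G \<Longrightarrow> independent_sets (G \<restriction> X) = {I \<in> independent_sets G. I \<subseteq> X}"
proof -
  have "u \<rightarrow>\<^bsub>G \<restriction> X\<^esub> v \<longleftrightarrow> u \<rightarrow>\<^bsub>G\<^esub> v \<and> u \<in> X \<and> v \<in> X" for u v
    by (auto simp: arcs_ends_conv)
  then show "independent_sets (G \<restriction> X) = {I \<in> independent_sets G. I \<subseteq> X}" if "X \<subseteq> verts G"
    using that by (auto simp: independent_sets_def subset_iff)
qed

lemma (in graph) card_le_independence_number:
  assumes "X \<subseteq> verts G" "I \<in> independent_sets G" "I \<subseteq> X"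
  shows "card I \<le> independence_number (G \<restriction> X)"
proof -
  have "graph G" by unfold_locales
  then show ?thesis
    using assms finite_independent_sets[of G]
    by (auto simp: independence_number_def independent_sets_induce intro!: Max_ge)
qed

text \<open>Consider the latest bag \<open>m\<close> at which a vertex of \<open>L\<close> appears first, say \<open>a\<close>. If \<open>m\<close> misses
  some \<open>a' \<in> L\<close>, then \<open>a'\<close> occurs only before \<open>m\<close> and \<open>a\<close> only from \<open>m\<close> on, so every common
  neighbour of the two lies in the bag \<open>m\<close>.\<close>
lemma path_decomposition_biclique:
  assumes pd: "path_decomposition G Xs" and L: "finite L" "L \<subseteq> verts G"
    and adj: "\<And>u v. u \<in> L \<Longrightarrow> v \<in> R \<Longrightarrow> u \<rightarrow>\<^bsub>G\<^esub> v"
  shows "\<exists>X\<in>set Xs. L \<subseteq> X \<or> R \<subseteq> X"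
proof (cases "L = {}")
  case True
  with pd show ?thesis
    by (auto simp: path_decomposition_def intro: hd_in_set)
next
  case False
  define first where "first v = (LEAST i. i < length Xs \<and> v \<in> Xs ! i)" for v
  have occ: "first v < length Xs \<and> v \<in> Xs ! first v" if "v \<in> L" for v
  proof -
    from that pd L(2) obtain X where "X \<in> set Xs" "v \<in> X"
      unfolding path_decomposition_def by blast
    then have "\<exists>i. i < length Xs \<and> v \<in> Xs ! i"
      by (auto simp: in_set_conv_nth)
    then show ?thesis
      unfolding first_def by (rule LeastI_ex)
  qed
  have first_le: "first v \<le> i" if "i < length Xs" "v \<in> Xs ! i" for i v
    unfolding first_def using that by (intro Least_le) auto
  have interval: "v \<in> Xs ! j" if "i \<le> j" "j \<le> k" "k < length Xs" "v \<in> Xs ! i" "v \<in> Xs ! k" for v i j k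
    using pd that unfolding path_decomposition_def by blast
  have common: "\<exists>i<length Xs. u \<in> Xs ! i \<and> v \<in> Xs ! i" if "u \<in> L" "v \<in> R" for u v
  proof -
    from adj[OF that] pd obtain X where "X \<in> set Xs" "u \<in> X" "v \<in> X"
      unfolding path_decomposition_def by blast
    then show ?thesis
      by (auto simp: in_set_conv_nth)
  qed
  have "Max (first ` L) \<in> first ` L"
    using L(1) False by (intro Max_in) auto
  then obtain a where a: "a \<in> L" "first a = Max (first ` L)"
    by auto
  define m where "m = first a"
  have m: "m < length Xs"
    using occ[OF a(1)] by (simp add: m_def)
  have max: "first v \<le> m" if "v \<in> L" for v
    using that L(1) a(2) by (simp add: m_def)
  have "R \<subseteq> Xs ! m" if "a' \<in> L" "a' \<notin> Xs ! m" for a'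
  proof
    fix b assume b: "b \<in> R"
    from common[OF a(1) b] obtain k where k: "k < length Xs" "a \<in> Xs ! k" "b \<in> Xs ! k"
      by blast
    from common[OF that(1) b] obtain i where i: "i < length Xs" "a' \<in> Xs ! i" "b \<in> Xs ! i"
      by blast
    \<comment> \<open>Since \<open>a'\<close> lies in bag \<open>first a' \<le> m\<close>, an
      occurrence in a bag beyond \<open>m\<close> would force it into bag \<open>m\<close>.\<close>
    have "i \<le> m"
      using interval[of "first a'" m i a'] occ[OF that(1)] max[OF that(1)] i that(2) by linarith
    moreover have "m \<le> k"
      using first_le[OF k(1,2)] by (simp add: m_def)
    ultimately show "b \<in> Xs ! m"
      using interval i k by blast
  qed
  then show ?thesis
    using m nth_mem by blast
qed

section \<open>The join of two disjoint unions of cliques\<close>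

text \<open>The cliques are the \<open>2t\<close> consecutive blocks of \<open>k\<close> vertices; the first \<open>t\<close> blocks are
  completely joined to the last \<open>t\<close>.\<close>
definition clique_join :: "nat \<Rightarrow> nat \<Rightarrow> (nat, nat \<times> nat) pre_digraph" where
  "clique_join t k =
    \<lparr>verts = {..<2 * (t * k)},
     arcs = {(u, v). u < 2 * (t * k) \<and> v < 2 * (t * k) \<and> u \<noteq> v \<and>
       (u div k = v div k \<or> (u < t * k) \<noteq> (v < t * k))},
     tail = fst, head = snd\<rparr>"

lemma verts_clique_join [simp]: "verts (clique_join t k) = {..<2 * (t * k)}"
  by (simp add: clique_join_def)

lemma adj_clique_join: "u \<rightarrow>\<^bsub>clique_join t k\<^esub> v \<longleftrightarrow>
    u < 2 * (t * k) \<and> v < 2 * (t * k) \<and> u \<noteq> v \<and> (u div k = v div k \<or> (u < t * k) \<noteq> (v < t * k))"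
  by (auto simp: arcs_ends_conv clique_join_def image_iff)

lemma graph_clique_join: "graph (clique_join t k)"
proof -
  have "finite (arcs (clique_join t k))"
    by (rule finite_subset[of _ "{..<2 * (t * k)} \<times> {..<2 * (t * k)}"]) (auto simp: clique_join_def)
  then have "digraph (clique_join t k)"
    by unfold_locales (auto simp: clique_join_def arc_to_ends_def)
  moreover have "symmetric (clique_join t k)"
    by (auto simp: symmetric_def adj_clique_join intro!: symI)
  ultimately show ?thesis
    by (rule digraph.graphI)
qed

text \<open>The join forces all vertices onto one side, and injectivity of \<open>u div k\<close>
  says that each block is met at most once.\<close>

lemma independent_clique_join_iff:
  "I \<in> independent_sets (clique_join t k) \<longleftrightarrow>
    (I \<subseteq> {..<t * k} \<or> I \<subseteq> {t * k..<2 * (t * k)}) \<and> inj_on (\<lambda>u. u div k) I"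
proof
  assume "I \<in> independent_sets (clique_join t k)"
  then have sub: "\<And>u. u \<in> I \<Longrightarrow> u < 2 * (t * k)"
    and indep: "\<And>u v. u \<in> I \<Longrightarrow> v \<in> I \<Longrightarrow> \<not> u \<rightarrow>\<^bsub>clique_join t k\<^esub> v"
    unfolding independent_sets_def by auto
  have same_side: "u < t * k \<longleftrightarrow> v < t * k" if "u \<in> I" "v \<in> I" for u v
    using indep[OF that] sub[OF that(1)] sub[OF that(2)] by (auto simp: adj_clique_join)
  have "I \<subseteq> {..<t * k} \<or> I \<subseteq> {t * k..<2 * (t * k)}"
  proof (cases "\<exists>u\<in>I. u < t * k")
    case True
    then show ?thesis using same_side by blast
  next
    case False
    then show ?thesis using sub by (auto simp: not_less)
  qed
  moreover have "inj_on (\<lambda>u. u div k) I"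
    by (rule inj_onI) (use indep sub in \<open>auto simp: adj_clique_join\<close>)
  ultimately show "(I \<subseteq> {..<t * k} \<or> I \<subseteq> {t * k..<2 * (t * k)}) \<and> inj_on (\<lambda>u. u div k) I" ..
next
  assume *: "(I \<subseteq> {..<t * k} \<or> I \<subseteq> {t * k..<2 * (t * k)}) \<and> inj_on (\<lambda>u. u div k) I"
  have "\<not> u \<rightarrow>\<^bsub>clique_join t k\<^esub> v" if "u \<in> I" "v \<in> I" for u v
  proof -
    have "u < t * k \<longleftrightarrow> v < t * k"
      using * that by (meson atLeastLessThan_iff lessThan_iff not_less subsetD)
    moreover have "u div k = v div k \<Longrightarrow> u = v"
      using * that by (auto dest: inj_onD)
    ultimately show ?thesis
      by (simp add: adj_clique_join) blast
  qed
  moreover have "I \<subseteq> {..<2 * (t * k)}"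
    using * by auto
  ultimately show "I \<in> independent_sets (clique_join t k)"
    by (simp add: independent_sets_def)
qed

lemma card_independent_clique_join:
  assumes "k > 0" "I \<in> independent_sets (clique_join t k)"
  shows "card I \<le> t"
proof -
  have inj: "inj_on (\<lambda>u. u div k) I"
    using assms(2) by (simp add: independent_clique_join_iff)
  consider "I \<subseteq> {..<t * k}" | "I \<subseteq> {t * k..<2 * (t * k)}"
    using assms(2) by (auto simp: independent_clique_join_iff)
  then show ?thesis
  proof cases
    case 1
    then have "(\<lambda>u. u div k) ` I \<subseteq> {..<t}"
      by (auto intro: less_mult_imp_div_less)
    from card_inj_on_le[OF inj this] show ?thesis by simp
  next
    case 2
    have "(\<lambda>u. u div k) ` I \<subseteq> {t..<2 * t}"
    proof (rule image_subsetI)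
      fix u assume "u \<in> I"
      with 2 have "t * k \<le> u" "u < 2 * t * k" by auto
      then show "u div k \<in> {t..<2 * t}"
        using assms(1) by (simp add: less_eq_div_iff_mult_less_eq less_mult_imp_div_less)
    qed
    from card_inj_on_le[OF inj this] show ?thesis by simp
  qed
qed

text \<open>For offsets \<open>f c\<close> below \<open>k\<close>, this picks one vertex from each
  left-hand clique.\<close>

definition transversal :: "nat \<Rightarrow> nat \<Rightarrow> (nat \<Rightarrow> nat) \<Rightarrow> nat set" where
  "transversal t k f = (\<lambda>c. c * k + f c) ` {..<t}"

lemma block_div: "r < k \<Longrightarrow> (c * k + r) div k = (c::nat)"
  by simp

lemma
  assumes f: "\<And>c. c < t \<Longrightarrow> f c < k"
  shows card_transversal: "card (transversal t k f) = t"
    and transversal_subset: "transversal t k f \<subseteq> {..<t * k}"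
    and inj_transversal: "inj_on (\<lambda>u. u div k) (transversal t k f)"
proof -
  have "inj_on ((\<lambda>u. u div k) \<circ> (\<lambda>c. c * k + f c)) {..<t}"
    by (rule inj_onI) (use f in \<open>auto simp: block_div\<close>)
  from inj_on_imageI[OF this] show "inj_on (\<lambda>u. u div k) (transversal t k f)"
    by (simp add: transversal_def)
  have "inj_on (\<lambda>c. c * k + f c) {..<t}"
    by (rule inj_onI) (metis block_div f lessThan_iff)
  then show "card (transversal t k f) = t"
    by (simp add: transversal_def card_image)
  have "c * k + f c < t * k" if "c < t" for c
  proof -
    have "c * k + f c < Suc c * k"
      using f[OF that] by simp
    also have "\<dots> \<le> t * k"
      using that by (intro mult_le_mono1) simp
    finally show ?thesis .
  qed
  then show "transversal t k f \<subseteq> {..<t * k}"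
    by (auto simp: transversal_def)
qed

lemma independent_transversal:
  assumes "\<And>c. c < t \<Longrightarrow> f c < k"
  shows "transversal t k f \<in> independent_sets (clique_join t k)"
  using transversal_subset[OF assms] inj_transversal[OF assms]
  by (simp add: independent_clique_join_iff)

text \<open>Division by \<open>k\<close> recovers the block and hence the offset. Extensional
  functions represent each choice of offsets once, so there are \<open>k ^ t\<close>
  transversals.\<close>

lemma inj_on_transversal: "inj_on (transversal t k) ({..<t} \<rightarrow>\<^sub>E {..<k})"
proof (rule inj_onI, rule PiE_ext)
  fix f g c
  assume f: "f \<in> {..<t} \<rightarrow>\<^sub>E {..<k}" and g: "g \<in> {..<t} \<rightarrow>\<^sub>E {..<k}"
    and eq: "transversal t k f = transversal t k g" and c: "c \<in> {..<t}"
  from c eq have "c * k + f c \<in> (\<lambda>c. c * k + g c) ` {..<t}"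
    by (auto simp: transversal_def)
  then obtain c' where c': "c' < t" "c * k + f c = c' * k + g c'"
    by auto
  then have "c = c'"
    using f g c block_div[of "f c" k c] block_div[of "g c'" k c'] by (auto simp: PiE_iff)
  with c' show "f c = g c" by simp
qed

lemma partition_function_clique_join_ge:
  assumes "lam > 0"
  shows "(real k * lam) ^ t \<le> partition_function (clique_join t k) lam"
proof -
  let ?F = "{..<t} \<rightarrow>\<^sub>E {..<k}"
  have "(real k * lam) ^ t = (\<Sum>f\<in>?F. lam ^ t)"
    by (simp add: card_PiE power_mult_distrib)
  also have "\<dots> = (\<Sum>f\<in>?F. lam ^ card (transversal t k f))"
    by (intro sum.cong refl) (auto simp: card_transversal PiE_iff)
  also have "\<dots> = (\<Sum>I\<in>transversal t k ` ?F. lam ^ card I)"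
    by (simp add: sum.reindex[OF inj_on_transversal])
  also have "\<dots> \<le> partition_function (clique_join t k) lam"
    unfolding partition_function_def using assms
    by (intro sum_mono2 finite_independent_sets graph_clique_join)
      (auto intro!: independent_transversal simp: PiE_iff)
  finally show ?thesis .
qed

text \<open>Some bag contains a whole side and hence an independent set of size \<open>t\<close>;
  conversely, the single bag of all vertices attains \<open>t\<close> because no independent set is
  larger.\<close>

lemma path_alpha_clique_join:
  assumes k: "k > 0"
  shows "path_alpha (clique_join t k) = t"
proof -
  let ?G = "clique_join t k"
  interpret graph ?G
    by (rule graph_clique_join)
  let ?T = "transversal t k (\<lambda>_. 0)"
  have T: "?T \<in> independent_sets ?G" "?T \<subseteq> {..<t * k}" "card ?T = t"
    using independent_transversal transversal_subset card_transversal k by simp_all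
  \<comment> \<open>Translating by \<open>t * k\<close> raises every block index by
    \<open>t\<close>, so the index stays injective.\<close>
  let ?U = "(\<lambda>u. u + t * k) ` ?T"
  have U: "?U \<in> independent_sets ?G" "?U \<subseteq> {t * k..<2 * (t * k)}" "card ?U = t"
  proof -
    show "?U \<subseteq> {t * k..<2 * (t * k)}"
      using T(2) by (auto simp: subset_iff mult.commute[of t k])
    moreover have "inj_on (\<lambda>u. u div k) ?U"
      using inj_transversal[of t "\<lambda>_. 0" k] k by (auto simp: inj_on_def)
    ultimately show "?U \<in> independent_sets ?G"
      by (simp add: independent_clique_join_iff)
    show "card ?U = t"
      using T(3) by (simp add: card_image)
  qed
  have lower: "t \<le> decomposition_independence ?G Xs" if pd: "path_decomposition ?G Xs" for Xs
  proof -
    have "\<exists>X\<in>set Xs. {..<t * k} \<subseteq> X \<or> {t * k..<2 * (t * k)} \<subseteq> X"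
      by (rule path_decomposition_biclique[OF pd]) (auto simp: adj_clique_join)
    then obtain X where X: "X \<in> set Xs" "{..<t * k} \<subseteq> X \<or> {t * k..<2 * (t * k)} \<subseteq> X"
      by blast
    have "X \<subseteq> verts ?G"
      using pd X(1) unfolding path_decomposition_def by blast
    then have "t \<le> independence_number (?G \<restriction> X)"
      using X(2) card_le_independence_number[of X ?T, OF _ T(1)]
        card_le_independence_number[of X ?U, OF _ U(1)] T(2,3) U(2,3)
      by (elim disjE) (metis subset_trans)+
    also have "\<dots> \<le> decomposition_independence ?G Xs"
      unfolding decomposition_independence_def using X(1) by (intro Max_ge) auto
    finally show ?thesis .
  qed
  have pd: "path_decomposition ?G [verts ?G]"
    by (auto simp: path_decomposition_def adj_clique_join)
  have "independent_sets (?G \<restriction> verts ?G) = independent_sets ?G"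
    unfolding independent_sets_induce[OF order_refl] by (auto simp: independent_sets_def)
  moreover have "Max (card ` independent_sets ?G) \<le> t"
    using card_independent_clique_join[OF k] finite_independent_sets[OF graph_clique_join, of t k]
      empty_independent[of ?G] by (intro Max.boundedI) blast+
  ultimately have "decomposition_independence ?G [verts ?G] \<le> t"
    by (simp add: decomposition_independence_def independence_number_def)
  then have "decomposition_independence ?G [verts ?G] = t"
    using lower[OF pd] by simp
  then show ?thesis
    unfolding path_alpha_def using pd lower by (intro Least_equality) auto
qed

section \<open>The bottleneck at the empty set\<close>

text \<open>The empty set, the only state lying on both sides, is left out to make the two families
  disjoint.\<close>

definition left_states :: "nat \<Rightarrow> nat \<Rightarrow> nat set set" where
  "left_states t k = {I \<in> independent_sets (clique_join t k). I \<noteq> {} \<and> I \<subseteq> {..<t * k}}"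

definition right_states :: "nat \<Rightarrow> nat \<Rightarrow> nat set set" where
  "right_states t k = {I \<in> independent_sets (clique_join t k). I \<noteq> {} \<and> I \<subseteq> {t * k..<2 * (t * k)}}"

lemma independent_sets_split:
  "independent_sets (clique_join t k) = insert {} (left_states t k \<union> right_states t k)"
proof (rule set_eqI)
  show "I \<in> independent_sets (clique_join t k) \<longleftrightarrow> I \<in> insert {} (left_states t k \<union> right_states t k)" for I
    unfolding left_states_def right_states_def
    using independent_clique_join_iff[of I t k] by (cases "I = {}") auto
qed

lemma left_right_disjoint: "I \<in> left_states t k \<Longrightarrow> I \<notin> right_states t k"
  by (fastforce simp: left_states_def right_states_def)

text \<open>Translation by \<open>t * k\<close> carries left blocks to right blocks and keeps
  cardinalities.\<close>

lemma sum_left_right: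
  fixes lam :: real
  assumes k: "k > 0"
  shows "(\<Sum>I\<in>right_states t k. lam ^ card I) = (\<Sum>I\<in>left_states t k. lam ^ card I)"
proof (rule sum.reindex_bij_witness[where j = "\<lambda>I. (\<lambda>u. u - t * k) ` I" and i = "\<lambda>I. (\<lambda>u. u + t * k) ` I"])
  fix I assume "I \<in> left_states t k"
  then have I: "I \<noteq> {}" "I \<subseteq> {..<t * k}" "inj_on (\<lambda>u. u div k) I"
    by (auto simp: left_states_def independent_clique_join_iff)
  show "(\<lambda>u. u - t * k) ` (\<lambda>u. u + t * k) ` I = I"
    by (simp add: image_image)
  have "inj_on (\<lambda>u. u div k) ((\<lambda>u. u + t * k) ` I)"
    using I(3) k by (auto simp: inj_on_def)
  moreover have "(\<lambda>u. u + t * k) ` I \<subseteq> {t * k..<2 * (t * k)}"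
    using I(2) by (auto simp: subset_iff mult.commute[of t k])
  ultimately show "(\<lambda>u. u + t * k) ` I \<in> right_states t k"
    using I(1) by (simp add: right_states_def independent_clique_join_iff)
next
  fix I assume "I \<in> right_states t k"
  then have I: "I \<noteq> {}" "I \<subseteq> {t * k..<2 * (t * k)}" "inj_on (\<lambda>u. u div k) I"
    by (auto simp: right_states_def independent_clique_join_iff)
  let ?J = "(\<lambda>u. u - t * k) ` I"
  \<comment> \<open>Truncated subtraction is harmless: every element of \<open>I\<close> is at least
    \<open>t * k\<close>.\<close>
  have "(\<lambda>u. u - t * k + t * k) ` I = id ` I"
    using I(2) by (intro image_cong) auto
  then show shift: "(\<lambda>u. u + t * k) ` ?J = I"
    by (simp add: image_image)
  show "lam ^ card ?J = lam ^ card I"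
    using card_image[of "\<lambda>u. u + t * k" ?J] unfolding shift by simp
  have "inj_on (\<lambda>u. u div k) ((\<lambda>u. u + t * k) ` ?J)"
    using I(3) unfolding shift .
  then have "inj_on (\<lambda>u. u div k) ?J"
    using k by (auto simp: inj_on_def)
  moreover have "?J \<subseteq> {..<t * k}"
  proof (rule image_subsetI)
    fix u assume "u \<in> I"
    with I(2) have "t * k \<le> u \<and> u < 2 * (t * k)" by auto
    then show "u - t * k \<in> {..<t * k}"
      unfolding lessThan_iff by linarith
  qed
  ultimately show "?J \<in> left_states t k"
    using I(1) by (simp add: left_states_def independent_clique_join_iff)
qed

lemma mixing_time_clique_join:
  assumes t: "t > 0" and k: "k > 0" and lam: "lam \<ge> 1"
  shows "(real k * lam) ^ t / 36 \<le> real (mixing_time (clique_join t k) lam)"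
proof -
  let ?G = "clique_join t k"
  let ?S = "left_states t k"
  interpret G: graph ?G
    by (rule graph_clique_join)
  interpret hardcore_chain ?G lam
    by unfold_locales (use lam t k in \<open>auto simp: lessThan_empty_iff\<close>)
  define Z where "Z = partition_function ?G lam"
  define w where "w = (\<Sum>I\<in>?S. lam ^ card I)"
  define s where "s = measure_pmf.prob \<pi> ?S"
  have Z0: "Z > 0"
    unfolding Z_def by (rule partition_function_pos[OF graph_clique_join lam_pos])
  have fin: "finite ?S" "finite (right_states t k)"
    using finite_states by (simp_all add: independent_sets_split)
  have Zw: "Z = 1 + 2 * w"
    unfolding Z_def partition_function_def independent_sets_split w_def
    using fin left_right_disjoint
    by (subst sum.insert) (auto simp: left_states_def right_states_def sum.union_disjoint
        sum_left_right[OF k, unfolded right_states_def left_states_def] disjoint_iff)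
  have w: "1 \<le> w"
  proof -
    \<comment> \<open>One singleton of weight \<open>lam \<ge> 1\<close> already keeps
      \<open>s = w / (1 + 2 * w)\<close> at or above 1/3, hence away from the threshold 1/4.\<close>
    have "{0} \<in> ?S"
      using t k by (simp add: left_states_def independent_clique_join_iff)
    then have "lam ^ card {0::nat} \<le> w"
      unfolding w_def using fin lam_pos by (intro member_le_sum) auto
    then show ?thesis
      using lam by simp
  qed
  have sw: "s = w / Z"
    unfolding s_def w_def Z_def prob_eq_sum_pmf[OF finite_states set_stationary]
    by (simp add: sum_divide_distrib pmf_stationary left_states_def Int_def)
  have s: "1 / 3 \<le> s" "s \<le> 1 / 2"
    unfolding sw Zw using w by (simp_all add: field_simps)
  have "Z / 36 \<le> (1 - s) * (s - 1 / 4) * Z"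
  proof -
    \<comment> \<open>\<open>1 - s\<close> is at least 1/2, here weakened to 1/3, and
      \<open>s - 1 / 4\<close> is at least 1/3 - 1/4 = 1/12; the product is 1/36.\<close>
    have "1 / 3 * (1 / 12) \<le> (1 - s) * (s - 1 / 4)"
      using s by (intro mult_mono) auto
    from mult_right_mono[OF this, of Z] show ?thesis
      using Z0 by simp
  qed
  also have "\<dots> \<le> real (mixing_time ?G lam)"
    unfolding Z_def s_def
  proof (rule mixing_time_bottleneck)
    fix J assume J: "J \<in> independent_sets ?G" "J \<notin> ?S" "J \<noteq> {}"
    then have R: "J \<subseteq> {t * k..<2 * (t * k)}"
      by (auto simp: left_states_def independent_clique_join_iff)
    have "I \<notin> ?S" if I: "I \<in> set_pmf (site_update ?G lam v J)" for v I
    proof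
      assume "I \<in> ?S"
      then have L: "I \<noteq> {}" "I \<subseteq> {..<t * k}"
        by (auto simp: left_states_def)
      \<comment> \<open>A single-site move yields a comparable set, so two nonempty states joined by
        a move share a vertex, which cannot lie on both sides.\<close>
      have "I \<subseteq> J \<or> J \<subseteq> I"
        using set_site_update[OF I] by auto
      with L(1) J(3) obtain x where "x \<in> I" "x \<in> J"
        by blast
      with subsetD[OF L(2)] subsetD[OF R] show False
        by fastforce
    qed
    then show "set_pmf (glauber_step ?G lam J) \<inter> ?S = {}"
      unfolding set_glauber_step by blast
  qed
  finally show ?thesis
    using partition_function_clique_join_ge[OF lam_pos, of k t] unfolding Z_def by simp
qed

section \<open>Assembling the infinite family\<close>

lemma digraph_iso_card_verts: "digraph_iso G H \<Longrightarrow> card (verts H) = card (verts G)"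
  by (auto simp: digraph_iso_def pre_digraph.digraph_isomorphism_def card_image)

theorem theorem13:
  fixes t :: nat
  assumes "t \<ge> 1"
  shows "\<exists>c::real. c > 0 \<and>
    (\<exists>\<G> :: (nat, nat \<times> nat) pre_digraph set.
       infinite \<G> \<and>
       (\<forall>G\<in>\<G>. \<forall>H\<in>\<G>. digraph_iso G H \<longrightarrow> G = H) \<and>
       (\<forall>G\<in>\<G>. graph G \<and> path_alpha G = t \<and>
          (\<forall>lam::real. lam \<ge> 1 \<longrightarrow>
             real (mixing_time G lam) \<ge> c * (real (card (verts G)) * lam) ^ t)))"
proof (intro exI conjI ballI impI allI)
  \<comment> \<open>With \<open>n = 2 * t * k\<close>, the power \<open>(n * lam) ^ t\<close> is
    \<open>(2 * t) ^ t\<close> times \<open>(k * lam) ^ t\<close>; the 36 comes from the bottleneck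
    bound.\<close>
  let ?c = "1 / (36 * (2 * real t) ^ t)"
  let ?\<G> = "clique_join t ` {0<..}"
  show "?c > 0"
    using assms by simp
  \<comment> \<open>For \<open>t \<ge> 1\<close> the number \<open>2 * t * k\<close> of vertices
    determines \<open>k\<close>. This yields both the infinitude of the family and that distinct
    members are not isomorphic.\<close>
  have eq: "clique_join t k = clique_join t l \<and> k = l"
    if "card (verts (clique_join t k)) = card (verts (clique_join t l))" for k l
    using that assms by simp
  have "inj_on (clique_join t) {0<..}"
  proof (rule inj_onI)
    fix k l assume "clique_join t k = clique_join t l"
    then show "k = l" using eq[of k l] by simp
  qed
  then show "infinite ?\<G>"
    by (simp add: finite_image_iff infinite_Ioi)
  show "G = H" if GH: "G \<in> ?\<G>" "H \<in> ?\<G>" "digraph_iso G H" for G H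
  proof -
    obtain k l where "G = clique_join t k" "H = clique_join t l"
      using GH(1,2) by blast
    then show ?thesis
      using eq[of k l] digraph_iso_card_verts[OF GH(3)] by metis
  qed
  fix G assume "G \<in> ?\<G>"
  then obtain k where k: "k > 0" and G: "G = clique_join t k"
    by auto
  show "graph G" "path_alpha G = t"
    using k by (simp_all add: G graph_clique_join path_alpha_clique_join)
  fix lam :: real assume lam: "lam \<ge> 1"
  have "(real (card (verts G)) * lam) ^ t = (2 * real t) ^ t * (real k * lam) ^ t"
    by (simp add: G power_mult_distrib mult.assoc)
  then have "?c * (real (card (verts G)) * lam) ^ t = (real k * lam) ^ t / 36"
    using assms by simp
  also have "\<dots> \<le> real (mixing_time G lam)"
    unfolding G using assms k lam by (intro mixing_time_clique_join) auto
  finally show "?c * (real (card (verts G)) * lam) ^ t \<le> real (mixing_time G lam)" .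
qed

end
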